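(* Let $\mu,\nu$ be real. (i) For all $x>0$, $$I_{\nu}(x)\,\tilde{t}_{\mu-1,\nu-1}(x)-I_{\nu-1}(x)\,\tilde{t}_{\mu,\nu}(x)>0, \qquad (A)$$ provided that either $\mu>-1$, $\nu\geq-1$ and $|\nu|<\mu+1$, or $\mu>-1$, $\nu>-1$ and $-\mu-1\leq\nu<\mu+1$. There is equality in (A) if $\mu-\nu=-1$, or if $\nu=-1$ and $\mu=0$. Also, for all $x>0$, $$I_{\nu}(x)\,\tilde{t}_{\mu-1,\nu-1}(x)-I_{\nu-1}(x)\,\tilde{t}_{\mu,\nu}(x)<a_{\mu,\nu}(x)I_{\nu}(x), \qquad (B)$$ $$I_{\nu}(x)\,\tilde{t}_{\mu-1,\nu-1}(x)-I_{\nu-1}(x)\,\tilde{t}_{\mu,\nu}(x)<a_{\mu-1,\nu-1}(x)I_{\nu-1}(x). \qquad (C)$$ Inequality (B) holds if either $\mu>-2$, $\nu\geq-2$ and $|\nu+1|<\mu+2$, or $\mu>-2$, $\nu>-2$ and $-\mu-2\leq\nu+1<\mu+2$; there is equality in (B) if $\mu-\nu=-1$, or if $\mu=-1$ and $\nu=-2$. Inequality (C) holds if either $\mu>0$, $\nu\geq0$ and $|\nu-1|<\mu$, or $\mu>0$, $\nu>0$ and $-\mu\leq\nu-1<\mu$; there is equality in (C) if $\mu-\nu=-1$, or if $\mu=1$ and $\nu=0$. (ii) For all $x>0$, $\mu>-1$ and $0\leq\nu<\mu+1$, $$\bigg(\frac{I_{\nu-1}(x)}{I_\nu(x)}+\frac{2b_{\mu,\nu}(x)}{x}\bigg)^{-1}<\frac{\tilde{t}_{\mu,\nu}(x)}{\tilde{t}_{\mu-1,\nu-1}(x)}<\frac{I_{\nu}(x)}{I_{\nu-1}(x)}.$$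 There is equality in the upper bound if $\mu-\nu=-1$ and $\nu\geq0$.
   Context: For real $\mu,\nu$ and $x>0$, the (normalized) modified Lommel function of the first kind is $$\tilde{t}_{\mu,\nu}(x)=\sum_{k=0}^\infty\frac{(\frac{1}{2}x)^{\mu+2k+1}}{\Gamma\big(k+\frac{\mu-\nu+3}{2}\big)\Gamma\big(k+\frac{\mu+\nu+3}{2}\big)},$$ and the modified Bessel function of the first kind is $$I_\nu(x)=\sum_{k=0}^\infty\frac{(\frac{1}{2}x)^{2k+\nu}}{k!\,\Gamma(k+\nu+1)},$$ where $1/\Gamma(z)$ is interpreted as $0$ for $z=0,-1,-2,\ldots$. Define $$a_{\mu,\nu}(x)=\frac{(x/2)^\mu}{\Gamma\big(\frac{\mu-\nu+1}{2}\big)\Gamma\big(\frac{\mu+\nu+3}{2}\big)}$$ (with the same convention, so that e.g. $a_{\mu,\nu}(x)=0$ if $\mu-\nu=-1$ or $\mu+\nu=-3$), and, for $\mu>-2$ and $|\nu+1|<\mu+2$, $$b_{\mu,\nu}(x)=\frac{x\,a_{\mu,\nu}(x)}{2\,\tilde{t}_{\mu,\nu}(x)}.$$ *)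

theory Defs
  imports "HOL-Analysis.Analysis"
begin

text \<open>
  The reciprocal Gamma function \<^term>\<open>rGamma\<close> vanishes at the nonpositive integers, which is
  the convention for \<open>1/\<Gamma>\<close> in all formulas below.  The functions are meant for \<open>x > 0\<close>.
\<close>

definition lommel_t :: "real \<Rightarrow> real \<Rightarrow> real \<Rightarrow> real" where
  "lommel_t \<mu> \<nu> x =
     (\<Sum>k. (x / 2) powr (\<mu> + 2 * real k + 1)
            * rGamma (real k + (\<mu> - \<nu> + 3) / 2) * rGamma (real k + (\<mu> + \<nu> + 3) / 2))"

definition bessel_I :: "real \<Rightarrow> real \<Rightarrow> real" where
  "bessel_I \<nu> x =
     (\<Sum>k. (x / 2) powr (2 * real k + \<nu>) / fact k * rGamma (real k + \<nu> + 1))"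

definition lommel_a :: "real \<Rightarrow> real \<Rightarrow> real \<Rightarrow> real" where
  "lommel_a \<mu> \<nu> x =
     (x / 2) powr \<mu> * rGamma ((\<mu> - \<nu> + 1) / 2) * rGamma ((\<mu> + \<nu> + 3) / 2)"

text \<open>Only meaningful for \<open>\<mu> > -2\<close> and \<open>\<bar>\<nu> + 1\<bar> < \<mu> + 2\<close>, where \<open>lommel_t \<mu> \<nu> x > 0\<close> for \<open>x > 0\<close>.\<close>

definition lommel_b :: "real \<Rightarrow> real \<Rightarrow> real \<Rightarrow> real" where
  "lommel_b \<mu> \<nu> x = x * lommel_a \<mu> \<nu> x / (2 * lommel_t \<mu> \<nu> x)"

end

theory Submission
  imports Defs
begin

text \<open>
  Write \<open>D \<mu> \<nu> = I\<^bsub>\<nu>\<^esub> t\<^bsub>\<mu>-1,\<nu>-1\<^esub> - I\<^bsub>\<nu>-1\<^esub> t\<^bsub>\<mu>,\<nu>\<^esub>\<close>.  The partial sums of the coefficients of its Cauchy product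
  telescope, and with \<open>d = (\<mu> - \<nu> + 1) / 2\<close> this gives
  \<open>D \<mu> \<nu> = (\<Sum>n. (x/2)\<^bsup>\<mu>+\<nu>+2n\<^esup> / (n! \<Gamma>(n+\<nu>+1) \<Gamma>(d) \<Gamma>(d+\<nu>) (n+d+\<nu>)))\<close>, which is visibly positive in case (A).
  Since \<open>I\<^bsub>\<nu>\<^esub> = t\<^bsub>\<nu>-1,\<nu>\<^esub>\<close>, both factors satisfy the recurrence
  \<open>t\<^bsub>\<mu>-1,\<nu>-1\<^esub> = t\<^bsub>\<mu>+1,\<nu>+1\<^esub> + (2\<nu>/x) t\<^bsub>\<mu>,\<nu>\<^esub> + a\<^bsub>\<mu>,\<nu>\<^esub>\<close>, whence \<open>D \<mu> \<nu> = a\<^bsub>\<mu>,\<nu>\<^esub> I\<^bsub>\<nu>\<^esub> - D (\<mu>+1) (\<nu>+1)\<close>.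
  So (B) is (A) at \<open>(\<mu>+1, \<nu>+1)\<close> and (C) is (A) at \<open>(\<mu>-1, \<nu>-1)\<close>.
\<close>

section \<open>Recurrence and sign of the reciprocal Gamma function\<close>

lemma rGamma_rec: "rGamma z = z * rGamma (z + 1 :: real)"
  by (simp add: rGamma_plus1)

lemma rGamma_pochhammer: "rGamma z = pochhammer z n * rGamma (z + real n)"
proof (induction n)
  case (Suc n)
  then show ?case
    using rGamma_rec[of "z + real n"] by (simp add: pochhammer_Suc add_ac)
qed simp

lemma rGamma_real_pos: "x > 0 \<Longrightarrow> rGamma (x :: real) > 0"
  by (simp add: rGamma_inverse_Gamma)

lemma rGamma_real_nonneg: "x \<ge> 0 \<Longrightarrow> rGamma (x :: real) \<ge> 0"
  using rGamma_real_pos[of x] by (cases "x = 0") auto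

section \<open>Power series with two reciprocal Gamma factors\<close>

text \<open>Common shape of the Lommel and Bessel series: with the real power of
  \<open>x / 2\<close> pulled out and \<open>y = (x / 2)^2\<close>, only natural exponents
  remain.\<close>

definition rGamma_term :: "real \<Rightarrow> real \<Rightarrow> real \<Rightarrow> nat \<Rightarrow> real" where
  "rGamma_term a b y k = y ^ k * rGamma (real k + a) * rGamma (real k + b)"

definition rGamma_powser :: "real \<Rightarrow> real \<Rightarrow> real \<Rightarrow> real" where
  "rGamma_powser a b y = (\<Sum>k. rGamma_term a b y k)"

lemma summable_norm_rGamma_term: "summable (\<lambda>k. norm (rGamma_term a b y k))"
proof -
  \<comment> \<open>For \<open>k \<ge> N\<close> this gives
    \<open>k + a \<ge> 2 * \<bar>y\<bar>\<close> and \<open>k + b \<ge> 1\<close>, so the ratio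
    \<open>\<bar>y\<bar> / ((k + a) * (k + b))\<close> of consecutive terms is at most 1/2.\<close>
  obtain N :: nat where N: "real N \<ge> \<bar>a\<bar> + \<bar>b\<bar> + 2 * \<bar>y\<bar> + 1"
    using real_arch_simple by blast
  have "norm (rGamma_term a b y (Suc k)) \<le> 1/2 * norm (rGamma_term a b y k)" if "k \<ge> N" for k
  proof -
    let ?r = "\<bar>y ^ k * rGamma (real k + a + 1) * rGamma (real k + b + 1)\<bar>"
    have k: "real k + a \<ge> 2 * \<bar>y\<bar>" "real k + b \<ge> 1"
      using N that by linarith+
    have "2 * \<bar>y\<bar> * 1 \<le> (real k + a) * (real k + b)"
      using k by (intro mult_mono) auto
    hence "\<bar>y\<bar> * ?r \<le> 1/2 * ((real k + a) * (real k + b)) * ?r"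
      by (intro mult_right_mono) auto
    moreover have "norm (rGamma_term a b y (Suc k)) = \<bar>y\<bar> * ?r"
      by (simp add: rGamma_term_def abs_mult add_ac mult_ac)
    moreover have "norm (rGamma_term a b y k) = (real k + a) * (real k + b) * ?r"
      using k rGamma_rec[of "real k + a"] rGamma_rec[of "real k + b"]
      by (simp add: rGamma_term_def abs_mult)
    ultimately show ?thesis by simp
  qed
  thus ?thesis
    by (intro summable_ratio_test[where c = "1/2" and N = N]) auto
qed

lemma rGamma_powser_sums: "rGamma_term a b y sums rGamma_powser a b y"
  using summable_norm_cancel[OF summable_norm_rGamma_term] summable_sums
  unfolding rGamma_powser_def by blast

lemma rGamma_powser_pos:
  assumes "a > 0" "b \<ge> 0" "y > 0"
  shows "rGamma_powser a b y > 0"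
  unfolding rGamma_powser_def
proof (rule suminf_pos2)
  show "summable (rGamma_term a b y)"
    using rGamma_powser_sums by (rule sums_summable)
  show "0 \<le> rGamma_term a b y k" for k
    unfolding rGamma_term_def using assms by (intro mult_nonneg_nonneg rGamma_real_nonneg) auto
  \<comment> \<open>The term at index 0 vanishes when \<open>b = 0\<close>, hence index 1.\<close>
  show "0 < rGamma_term a b y 1"
    unfolding rGamma_term_def using assms by (intro mult_pos_pos rGamma_real_pos) auto
qed

text \<open>Split the factor in \<open>rGamma (k + b) = (k + b) * rGamma (k + b + 1)\<close> as
  \<open>(b - a + 1) + (k + a - 1)\<close>; the second summand turns \<open>rGamma (k + a)\<close>
  into \<open>rGamma (k + a - 1)\<close>. An index shift in that series then leaves its term at 0 as
  the inhomogeneity.\<close>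

lemma rGamma_powser_rec:
  "rGamma_powser a b y =
     y * rGamma_powser a (b + 2) y + (b - a + 1) * rGamma_powser a (b + 1) y
       + rGamma (a - 1) * rGamma (b + 1)"
proof -
  have "rGamma_term a b y k =
      (b - a + 1) * rGamma_term a (b + 1) y k + rGamma_term (a - 1) (b + 1) y k" for k
  proof -
    have 1: "rGamma (real k + b) = (real k + b) * rGamma (real k + (b + 1))"
      using rGamma_rec[of "real k + b"] by (simp add: add_ac)
    have 2: "rGamma (real k + (a - 1)) = (real k + (a - 1)) * rGamma (real k + a)"
      using rGamma_rec[of "real k + (a - 1)"] by (simp add: add_ac)
    show ?thesis unfolding rGamma_term_def 1 2 by (simp add: algebra_simps)
  qed
  hence "(\<lambda>k. rGamma_term a b y k) sums
      ((b - a + 1) * rGamma_powser a (b + 1) y + rGamma_powser (a - 1) (b + 1) y)"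
    by (simp add: sums_add sums_mult rGamma_powser_sums)
  hence 1: "rGamma_powser a b y =
      (b - a + 1) * rGamma_powser a (b + 1) y + rGamma_powser (a - 1) (b + 1) y"
    using rGamma_powser_sums sums_unique2 by blast
  have "rGamma_term (a - 1) (b + 1) y (Suc k) = y * rGamma_term a (b + 2) y k" for k
    by (simp add: rGamma_term_def add_ac mult_ac)
  hence "(\<lambda>k. rGamma_term (a - 1) (b + 1) y (Suc k)) sums (y * rGamma_powser a (b + 2) y)"
    by (simp add: sums_mult rGamma_powser_sums)
  hence "rGamma_term (a - 1) (b + 1) y sums
      (y * rGamma_powser a (b + 2) y + rGamma_term (a - 1) (b + 1) y 0)"
    by (simp add: sums_Suc_iff)
  hence "rGamma_powser (a - 1) (b + 1) y =
      y * rGamma_powser a (b + 2) y + rGamma (a - 1) * rGamma (b + 1)"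
    using sums_unique2[OF rGamma_powser_sums] by (simp add: rGamma_term_def)
  with 1 show ?thesis by simp
qed

section \<open>Telescoping of the Cauchy product coefficients\<close>

text \<open>
  The factor \<open>u - 2 j\<close> makes the summand a difference of consecutive terms after multiplication by
  \<open>u + \<nu>\<close>; stating the sum with the Pochhammer symbol avoids dividing by \<open>u + \<nu>\<close>, which may be \<open>0\<close>.
\<close>
lemma rGamma_telescope:
  "(\<Sum>j\<le>m. (u - 2 * real j) * (rGamma (real j + 1) * rGamma (real j + \<nu> + 1))
       * (rGamma (u - real j + 1) * rGamma (u - real j + \<nu> + 1)))
     = rGamma (real m + 1) * rGamma (real m + \<nu> + 1)
       * (rGamma (u - real m) * pochhammer (u + \<nu> - real m) m * rGamma (u + \<nu> + 1))"
proof (induction m)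
  case 0
  show ?case using rGamma_rec[of u] by (simp add: add_ac mult_ac)
next
  case (Suc m)
  define v where "v = real m + 1"
  define P where "P = pochhammer (u + \<nu> - real m) m"
  define g where "g = rGamma (v + 1) * rGamma (v + \<nu> + 1)"
  define r where "r = rGamma (u - v + 1)"
  define R where "R = rGamma (u + \<nu> + 1)"
  have S: "real (Suc m) = v" "real m = v - 1" by (simp_all add: v_def)
  have g: "rGamma (real m + 1) * rGamma (real m + \<nu> + 1) = v * (v + \<nu>) * g"
    using rGamma_rec[of v] rGamma_rec[of "v + \<nu>"] by (simp add: g_def v_def algebra_simps)
  have r: "rGamma (u - real m) = r" "rGamma (u - v) = (u - v) * r"
    using rGamma_rec[of "u - v"] by (simp_all add: r_def v_def algebra_simps)
  have q: "rGamma (u - v + \<nu> + 1) = P * (u + \<nu>) * R"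
    using rGamma_pochhammer[of "u - v + \<nu> + 1" "Suc m"]
    by (simp add: P_def R_def v_def pochhammer_Suc algebra_simps)
  have p: "pochhammer (u + \<nu> - v) (Suc m) = (u + \<nu> - v) * P"
    by (simp add: pochhammer_rec P_def v_def algebra_simps)
  \<comment> \<open>After cancelling \<open>g * r * P * R\<close> this is \<open>v * (v + \<nu>) +
    (u - 2 * v) * (u + \<nu>) = (u - v) * (u + \<nu> - v)\<close>.\<close>
  have "v * (v + \<nu>) * g * (r * P * R) + (u - 2 * v) * g * (r * (P * (u + \<nu>) * R))
      = g * ((u - v) * r * ((u + \<nu> - v) * P) * R)"
    by algebra
  thus ?case
    unfolding sum.atMost_Suc Suc.IH S(1) g r(1) p r(2) q P_def[symmetric]
    by (simp add: g_def r_def R_def)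
qed

text \<open>The telescoped sum at \<open>m = n\<close>, \<open>u = n + d\<close>. Away from poles
  its last bracket is 1 / (\<Gamma>(d) \<Gamma>(d+\<nu>) (n+d+\<nu>)).\<close>

definition cross_term :: "real \<Rightarrow> real \<Rightarrow> real \<Rightarrow> nat \<Rightarrow> real" where
  "cross_term d \<nu> y n = y ^ n * (rGamma (real n + 1) * rGamma (real n + \<nu> + 1)
     * (rGamma d * pochhammer (d + \<nu>) n * rGamma (real n + d + \<nu> + 1)))"

text \<open>Raising \<open>rGamma (u - j + \<nu>)\<close> in one product and
  \<open>rGamma (j + \<nu>)\<close> in the other by the recurrence makes the remaining Gamma factors
  agree; the difference of the prefactors is \<open>u - 2 * j\<close>, which telescopes.\<close>

lemma cross_term_sums:
  "cross_term d \<nu> y sums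
     (rGamma_powser 1 (\<nu> + 1) y * rGamma_powser (d + 1) (d + \<nu>) y
      - rGamma_powser 1 \<nu> y * rGamma_powser (d + 1) (d + \<nu> + 1) y)"
proof -
  let ?c = "\<lambda>a b a' b' n. \<Sum>i\<le>n. rGamma_term a b y i * rGamma_term a' b' y (n - i)"
  have diff: "?c 1 (\<nu> + 1) (d + 1) (d + \<nu>) n - ?c 1 \<nu> (d + 1) (d + \<nu> + 1) n = cross_term d \<nu> y n" for n
  proof -
    define u where "u = real n + d"
    have "rGamma_term 1 (\<nu> + 1) y j * rGamma_term (d + 1) (d + \<nu>) y (n - j)
          - rGamma_term 1 \<nu> y j * rGamma_term (d + 1) (d + \<nu> + 1) y (n - j)
        = y ^ n * ((u - 2 * real j) * (rGamma (real j + 1) * rGamma (real j + \<nu> + 1))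
            * (rGamma (u - real j + 1) * rGamma (u - real j + \<nu> + 1)))" if "j \<le> n" for j
    proof -
      have y: "y ^ n = y ^ j * y ^ (n - j)"
        using that by (simp flip: power_add)
      have r: "real (n - j) + (d + 1) = u - real j + 1"
        "real (n - j) + (d + \<nu>) = u - real j + \<nu>"
        "real (n - j) + (d + \<nu> + 1) = u - real j + \<nu> + 1"
        "real j + (\<nu> + 1) = real j + \<nu> + 1"
        using that by (simp_all add: u_def of_nat_diff)
      show ?thesis
        unfolding rGamma_term_def r y rGamma_rec[of "real j + \<nu>"] rGamma_rec[of "u - real j + \<nu>"]
        by algebra
    qed
    hence "?c 1 (\<nu> + 1) (d + 1) (d + \<nu>) n - ?c 1 \<nu> (d + 1) (d + \<nu> + 1) n
        = y ^ n * (\<Sum>j\<le>n. (u - 2 * real j) * (rGamma (real j + 1) * rGamma (real j + \<nu> + 1))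
            * (rGamma (u - real j + 1) * rGamma (u - real j + \<nu> + 1)))"
      unfolding sum_subtractf[symmetric] sum_distrib_left by (intro sum.cong) auto
    also have "\<dots> = cross_term d \<nu> y n"
      unfolding rGamma_telescope by (simp add: cross_term_def u_def add_ac)
    finally show ?thesis .
  qed
  have product: "?c a b a' b' sums (rGamma_powser a b y * rGamma_powser a' b' y)" for a b a' b'
    unfolding rGamma_powser_def
    by (intro Cauchy_product_sums summable_norm_rGamma_term)
  from sums_diff[OF product[of 1 "\<nu> + 1" "d + 1" "d + \<nu>"] product[of 1 \<nu> "d + 1" "d + \<nu> + 1"]]
  show ?thesis
    unfolding diff .
qed

text \<open>All terms are nonnegative. The disjunction excludes \<open>d + \<nu> = 0\<close> with
  \<open>\<nu> = -1\<close>, where every term vanishes.\<close>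

lemma cross_term_pos:
  assumes "d > 0" "\<nu> \<ge> -1" "d + \<nu> \<ge> 0" "d + \<nu> > 0 \<or> \<nu> > -1" "y > 0"
  shows "(\<Sum>n. cross_term d \<nu> y n) > 0"
proof (rule suminf_pos2)
  show "summable (cross_term d \<nu> y)"
    using cross_term_sums by (rule sums_summable)
  have "pochhammer (d + \<nu>) n \<ge> 0" for n
    using assms pochhammer_nonneg[of "d + \<nu>" n] by (cases "d + \<nu> = 0"; cases n) (auto simp: pochhammer_rec)
  thus "0 \<le> cross_term d \<nu> y n" for n
    unfolding cross_term_def using assms
    by (cases n) (auto intro!: mult_nonneg_nonneg rGamma_real_nonneg)
  \<comment> \<open>If \<open>d + \<nu> = 0\<close>, the Pochhammer symbol kills every term but the
    one at 0, which is positive as \<open>\<nu> > -1\<close>. Otherwise index 1 also covers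
    \<open>\<nu> = -1\<close>, where the term at 0 vanishes.\<close>
  show "0 < cross_term d \<nu> y (if d + \<nu> > 0 then 1 else 0)"
    unfolding cross_term_def using assms by (auto intro!: mult_pos_pos rGamma_real_pos)
qed

section \<open>Lommel and Bessel functions: series, positivity, recurrences\<close>

lemma lommel_t_eq:
  assumes "x > 0"
  shows "lommel_t \<mu> \<nu> x =
    (x / 2) powr (\<mu> + 1) * rGamma_powser ((\<mu> - \<nu> + 3) / 2) ((\<mu> + \<nu> + 3) / 2) ((x / 2)\<^sup>2)"
proof -
  let ?a = "(\<mu> - \<nu> + 3) / 2" and ?b = "(\<mu> + \<nu> + 3) / 2"
  have "(x / 2) powr (\<mu> + 2 * real k + 1) = (x / 2) powr (\<mu> + 1) * ((x / 2)\<^sup>2) ^ k" for k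
  proof -
    have "(x / 2) powr (\<mu> + 2 * real k + 1) = (x / 2) powr ((\<mu> + 1) + real (2 * k))"
      by (simp add: add_ac)
    thus ?thesis
      using assms by (simp only: powr_add powr_realpow power_mult half_gt_zero)
  qed
  hence "lommel_t \<mu> \<nu> x =
      (\<Sum>k. (x / 2) powr (\<mu> + 1) * rGamma_term ?a ?b ((x / 2)\<^sup>2) k)"
    by (simp add: lommel_t_def rGamma_term_def mult.assoc)
  also have "\<dots> = (x / 2) powr (\<mu> + 1) * rGamma_powser ?a ?b ((x / 2)\<^sup>2)"
    using rGamma_powser_sums by (intro sums_unique[symmetric] sums_mult)
  finally show ?thesis .
qed

text \<open>For \<open>\<mu> = \<nu> - 1\<close> the first reciprocal Gamma factor is
  \<open>rGamma (k + 1)\<close>, that is 1/k!.\<close>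

lemma bessel_I_eq_lommel_t: "bessel_I \<nu> x = lommel_t (\<nu> - 1) \<nu> x"
proof -
  have "rGamma (real k + 1) = 1 / fact k" for k
    using Gamma_fact[of k, where 'a = real]
    by (simp add: rGamma_inverse_Gamma add.commute inverse_eq_divide)
  moreover have e: "(\<nu> - 1 - \<nu> + 3) / 2 = 1" "(\<nu> - 1 + \<nu> + 3) / 2 = \<nu> + 1"
    by simp_all
  ultimately show ?thesis
    unfolding bessel_I_def lommel_t_def e by (simp add: add_ac)
qed

lemma bessel_I_eq:
  assumes "x > 0"
  shows "bessel_I \<nu> x = (x / 2) powr \<nu> * rGamma_powser 1 (\<nu> + 1) ((x / 2)\<^sup>2)"
proof -
  have "(\<nu> - 1 - \<nu> + 3) / 2 = 1" "(\<nu> - 1 + \<nu> + 3) / 2 = \<nu> + 1"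
    by simp_all
  thus ?thesis
    using lommel_t_eq[OF assms, of "\<nu> - 1" \<nu>] by (simp only: bessel_I_eq_lommel_t diff_add_cancel)
qed

lemma lommel_t_pos:
  assumes "\<mu> - \<nu> > -3" "\<mu> + \<nu> \<ge> -3" "x > 0"
  shows "lommel_t \<mu> \<nu> x > 0"
  unfolding lommel_t_eq[OF \<open>x > 0\<close>] using assms
  by (intro mult_pos_pos rGamma_powser_pos) auto

lemma bessel_I_pos:
  assumes "\<nu> \<ge> -1" "x > 0"
  shows "bessel_I \<nu> x > 0"
  unfolding bessel_I_eq_lommel_t using assms by (intro lommel_t_pos) auto

text \<open>The three functions share \<open>\<mu> - \<nu>\<close>, hence the parameter
  \<open>a\<close>, while \<open>b\<close> moves in unit steps, so \<open>rGamma_powser_rec\<close>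
  applies with \<open>b - a + 1 = \<nu>\<close>.\<close>

lemma lommel_t_rec:
  assumes x: "x > 0"
  shows "lommel_t (\<mu> - 1) (\<nu> - 1) x =
    lommel_t (\<mu> + 1) (\<nu> + 1) x + 2 * \<nu> / x * lommel_t \<mu> \<nu> x + lommel_a \<mu> \<nu> x"
proof -
  define a b where "a = (\<mu> - \<nu> + 3) / 2" and "b = (\<mu> + \<nu> + 1) / 2"
  define y where "y = (x / 2)\<^sup>2"
  define p where "p = (x / 2) powr \<mu>"
  have p: "(x / 2) powr (\<mu> + 1) = p * (x / 2)" "(x / 2) powr (\<mu> + 2) = p * y"
    using x by (simp_all add: p_def y_def powr_add powr_realpow)
  have t: "lommel_t (\<mu> - 1) (\<nu> - 1) x = p * rGamma_powser a b y"
    "lommel_t (\<mu> + 1) (\<nu> + 1) x = p * y * rGamma_powser a (b + 2) y"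
    "lommel_t \<mu> \<nu> x = p * (x / 2) * rGamma_powser a (b + 1) y"
    using x p by (simp_all add: lommel_t_eq a_def b_def y_def p_def add_divide_distrib diff_divide_distrib add_ac)
  have a: "lommel_a \<mu> \<nu> x = p * (rGamma (a - 1) * rGamma (b + 1))"
    by (simp add: lommel_a_def a_def b_def p_def add_divide_distrib diff_divide_distrib add_ac)
  have "b - a + 1 = \<nu>" by (simp add: a_def b_def field_simps)
  with rGamma_powser_rec[of a b y] have "rGamma_powser a b y =
      y * rGamma_powser a (b + 2) y + \<nu> * rGamma_powser a (b + 1) y + rGamma (a - 1) * rGamma (b + 1)"
    by simp
  thus ?thesis
    unfolding t a using x by (simp add: algebra_simps)
qed

text \<open>The inhomogeneity \<open>lommel_a (\<nu> - 1) \<nu> x\<close> contains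
  \<open>rGamma 0 = 0\<close>.\<close>

lemma bessel_I_rec:
  assumes "x > 0"
  shows "bessel_I (\<nu> - 1) x = bessel_I (\<nu> + 1) x + 2 * \<nu> / x * bessel_I \<nu> x"
  using lommel_t_rec[OF assms, of "\<nu> - 1" \<nu>] by (simp add: bessel_I_eq_lommel_t lommel_a_def)

section \<open>Sign and recurrence of the cross difference\<close>

definition cross :: "real \<Rightarrow> real \<Rightarrow> real \<Rightarrow> real" where
  "cross \<mu> \<nu> x = bessel_I \<nu> x * lommel_t (\<mu> - 1) (\<nu> - 1) x - bessel_I (\<nu> - 1) x * lommel_t \<mu> \<nu> x"

lemma cross_eq_suminf:
  assumes x: "x > 0"
  shows "cross \<mu> \<nu> x =
    (x / 2) powr (\<mu> + \<nu>) * (\<Sum>n. cross_term ((\<mu> - \<nu> + 1) / 2) \<nu> ((x / 2)\<^sup>2) n)"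
proof -
  define d where "d = (\<mu> - \<nu> + 1) / 2"
  define y where "y = (x / 2)\<^sup>2"
  have e: "(\<mu> - 1 - (\<nu> - 1) + 3) / 2 = d + 1" "(\<mu> - 1 + (\<nu> - 1) + 3) / 2 = d + \<nu>"
    "(\<mu> - \<nu> + 3) / 2 = d + 1" "(\<mu> + \<nu> + 3) / 2 = d + \<nu> + 1"
    by (simp_all add: d_def field_simps)
  have t: "lommel_t (\<mu> - 1) (\<nu> - 1) x = (x / 2) powr \<mu> * rGamma_powser (d + 1) (d + \<nu>) y"
    "lommel_t \<mu> \<nu> x = (x / 2) powr (\<mu> + 1) * rGamma_powser (d + 1) (d + \<nu> + 1) y"
    unfolding lommel_t_eq[OF x] e y_def by simp_all
  have I: "bessel_I \<nu> x = (x / 2) powr \<nu> * rGamma_powser 1 (\<nu> + 1) y"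
    "bessel_I (\<nu> - 1) x = (x / 2) powr (\<nu> - 1) * rGamma_powser 1 \<nu> y"
    by (simp_all add: bessel_I_eq[OF x] y_def)
  have distrib: "p * X * (q * Y) - p' * Z * (q' * W) = r * (X * Y - Z * W)"
    if "p * q = r" "p' * q' = r" for p q p' q' r X Y Z W :: real
  proof -
    have "p * X * (q * Y) - p' * Z * (q' * W) = (p * q) * (X * Y) - (p' * q') * (Z * W)"
      by (simp add: mult_ac)
    thus ?thesis by (simp add: that right_diff_distrib)
  qed
  \<comment> \<open>Both products carry the same total power \<open>\<mu> + \<nu>\<close>, which
    therefore factors out.\<close>
  have "(x / 2) powr \<nu> * (x / 2) powr \<mu> = (x / 2) powr (\<mu> + \<nu>)"
    "(x / 2) powr (\<nu> - 1) * (x / 2) powr (\<mu> + 1) = (x / 2) powr (\<mu> + \<nu>)"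
    by (simp_all flip: powr_add add: add_ac)
  hence "cross \<mu> \<nu> x = (x / 2) powr (\<mu> + \<nu>) *
      (rGamma_powser 1 (\<nu> + 1) y * rGamma_powser (d + 1) (d + \<nu>) y
       - rGamma_powser 1 \<nu> y * rGamma_powser (d + 1) (d + \<nu> + 1) y)"
    unfolding cross_def t I by (rule distrib)
  thus ?thesis
    using sums_unique[OF cross_term_sums[of d \<nu> y]] by (simp add: d_def y_def)
qed

text \<open>With \<open>d = (\<mu> - \<nu> + 1) / 2\<close>, \<open>d > 0\<close> means
  \<open>\<nu> < \<mu> + 1\<close>, and \<open>d + \<nu> \<ge> 0\<close> means
  \<open>-\<mu> - 1 \<le> \<nu>\<close>. The disjunction unites the two parameter ranges of
  (A).\<close>

lemma cross_pos:
  assumes "\<nu> < \<mu> + 1" "\<nu> \<ge> -1" "-\<mu> - 1 \<le> \<nu>" "-\<mu> - 1 < \<nu> \<or> \<nu> > -1" "x > 0"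
  shows "cross \<mu> \<nu> x > 0"
  unfolding cross_eq_suminf[OF \<open>x > 0\<close>] using assms
  by (intro mult_pos_pos cross_term_pos) (auto simp: field_simps)

text \<open>In the first case \<open>d = 0\<close> and \<open>rGamma d\<close> vanishes. In the
  second \<open>d + \<nu> = 0\<close>, so the Pochhammer symbol kills all terms with
  \<open>n > 0\<close>, and \<open>rGamma (\<nu> + 1) = rGamma 0\<close> kills the first.\<close>

lemma cross_eq_0:
  assumes "\<mu> - \<nu> = -1 \<or> \<nu> = -1 \<and> \<mu> = 0" "x > 0"
  shows "cross \<mu> \<nu> x = 0"
proof -
  have "cross_term ((\<mu> - \<nu> + 1) / 2) \<nu> y n = 0" for y n
    using assms(1) by (cases n) (auto simp: cross_term_def pochhammer_rec)
  thus ?thesis by (simp add: cross_eq_suminf[OF \<open>x > 0\<close>])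
qed

text \<open>The contributions with \<open>2 * \<nu> / x\<close> from the two recurrences
  cancel.\<close>

lemma cross_rec:
  assumes x: "x > 0"
  shows "cross \<mu> \<nu> x = lommel_a \<mu> \<nu> x * bessel_I \<nu> x - cross (\<mu> + 1) (\<nu> + 1) x"
  unfolding cross_def lommel_t_rec[OF x, of \<mu> \<nu>] bessel_I_rec[OF x, of \<nu>]
  by (simp add: algebra_simps)

section \<open>Bounds for the ratio of Lommel functions\<close>

text \<open>For \<open>\<nu> \<ge> 0\<close> all four function values are positive. The upper bound
  is (A) divided by two of them; the lower one is (B) divided by
  \<open>bessel_I \<nu> x * lommel_t \<mu> \<nu> x\<close> and inverted.\<close>

lemma lommel_t_ratio_bounds:
  assumes "\<mu> > -1" "0 \<le> \<nu>" "\<nu> < \<mu> + 1" and x: "x > 0"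
  shows "inverse (bessel_I (\<nu> - 1) x / bessel_I \<nu> x + 2 * lommel_b \<mu> \<nu> x / x)
           < lommel_t \<mu> \<nu> x / lommel_t (\<mu> - 1) (\<nu> - 1) x"
    and "lommel_t \<mu> \<nu> x / lommel_t (\<mu> - 1) (\<nu> - 1) x < bessel_I \<nu> x / bessel_I (\<nu> - 1) x"
proof -
  have I: "bessel_I \<nu> x > 0" "bessel_I (\<nu> - 1) x > 0"
    using assms by (auto intro!: bessel_I_pos)
  have t: "lommel_t \<mu> \<nu> x > 0" "lommel_t (\<mu> - 1) (\<nu> - 1) x > 0"
    using assms by (auto intro!: lommel_t_pos)
  have "cross \<mu> \<nu> x > 0"
    using assms by (intro cross_pos) auto
  thus "lommel_t \<mu> \<nu> x / lommel_t (\<mu> - 1) (\<nu> - 1) x < bessel_I \<nu> x / bessel_I (\<nu> - 1) x"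
    using I t by (simp add: cross_def field_simps)
  have "cross (\<mu> + 1) (\<nu> + 1) x > 0"
    using assms by (intro cross_pos) auto
  hence "bessel_I \<nu> x * lommel_t (\<mu> - 1) (\<nu> - 1) x
      < bessel_I (\<nu> - 1) x * lommel_t \<mu> \<nu> x + lommel_a \<mu> \<nu> x * bessel_I \<nu> x"
    using cross_rec[OF x, of \<mu> \<nu>] by (simp add: cross_def)
  hence "lommel_t (\<mu> - 1) (\<nu> - 1) x / lommel_t \<mu> \<nu> x
      < bessel_I (\<nu> - 1) x / bessel_I \<nu> x + lommel_a \<mu> \<nu> x / lommel_t \<mu> \<nu> x"
    using I t by (simp add: field_simps)
  also have "lommel_a \<mu> \<nu> x / lommel_t \<mu> \<nu> x = 2 * lommel_b \<mu> \<nu> x / x"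
    using x by (simp add: lommel_b_def)
  finally have "inverse (bessel_I (\<nu> - 1) x / bessel_I \<nu> x + 2 * lommel_b \<mu> \<nu> x / x)
      < inverse (lommel_t (\<mu> - 1) (\<nu> - 1) x / lommel_t \<mu> \<nu> x)"
    using t by (intro less_imp_inverse_less) auto
  thus "inverse (bessel_I (\<nu> - 1) x / bessel_I \<nu> x + 2 * lommel_b \<mu> \<nu> x / x)
      < lommel_t \<mu> \<nu> x / lommel_t (\<mu> - 1) (\<nu> - 1) x"
    by simp
qed


theorem theorem3p4:
  fixes \<mu> \<nu> :: real
  shows
    "(\<mu> > -1 \<and> \<nu> \<ge> -1 \<and> \<bar>\<nu>\<bar> < \<mu> + 1 \<or> \<mu> > -1 \<and> \<nu> > -1 \<and> -\<mu> - 1 \<le> \<nu> \<and> \<nu> < \<mu> + 1 \<longrightarrow>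
       (\<forall>x>0. bessel_I \<nu> x * lommel_t (\<mu> - 1) (\<nu> - 1) x - bessel_I (\<nu> - 1) x * lommel_t \<mu> \<nu> x > 0)) \<and>
     (\<mu> - \<nu> = -1 \<or> \<nu> = -1 \<and> \<mu> = 0 \<longrightarrow>
       (\<forall>x>0. bessel_I \<nu> x * lommel_t (\<mu> - 1) (\<nu> - 1) x - bessel_I (\<nu> - 1) x * lommel_t \<mu> \<nu> x = 0)) \<and>
     (\<mu> > -2 \<and> \<nu> \<ge> -2 \<and> \<bar>\<nu> + 1\<bar> < \<mu> + 2 \<or>
      \<mu> > -2 \<and> \<nu> > -2 \<and> -\<mu> - 2 \<le> \<nu> + 1 \<and> \<nu> + 1 < \<mu> + 2 \<longrightarrow>
       (\<forall>x>0. bessel_I \<nu> x * lommel_t (\<mu> - 1) (\<nu> - 1) x - bessel_I (\<nu> - 1) x * lommel_t \<mu> \<nu> x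
              < lommel_a \<mu> \<nu> x * bessel_I \<nu> x)) \<and>
     (\<mu> - \<nu> = -1 \<or> \<mu> = -1 \<and> \<nu> = -2 \<longrightarrow>
       (\<forall>x>0. bessel_I \<nu> x * lommel_t (\<mu> - 1) (\<nu> - 1) x - bessel_I (\<nu> - 1) x * lommel_t \<mu> \<nu> x
              = lommel_a \<mu> \<nu> x * bessel_I \<nu> x)) \<and>
     (\<mu> > 0 \<and> \<nu> \<ge> 0 \<and> \<bar>\<nu> - 1\<bar> < \<mu> \<or> \<mu> > 0 \<and> \<nu> > 0 \<and> -\<mu> \<le> \<nu> - 1 \<and> \<nu> - 1 < \<mu> \<longrightarrow>
       (\<forall>x>0. bessel_I \<nu> x * lommel_t (\<mu> - 1) (\<nu> - 1) x - bessel_I (\<nu> - 1) x * lommel_t \<mu> \<nu> x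
              < lommel_a (\<mu> - 1) (\<nu> - 1) x * bessel_I (\<nu> - 1) x)) \<and>
     (\<mu> - \<nu> = -1 \<or> \<mu> = 1 \<and> \<nu> = 0 \<longrightarrow>
       (\<forall>x>0. bessel_I \<nu> x * lommel_t (\<mu> - 1) (\<nu> - 1) x - bessel_I (\<nu> - 1) x * lommel_t \<mu> \<nu> x
              = lommel_a (\<mu> - 1) (\<nu> - 1) x * bessel_I (\<nu> - 1) x)) \<and>
     (\<mu> > -1 \<and> 0 \<le> \<nu> \<and> \<nu> < \<mu> + 1 \<longrightarrow>
       (\<forall>x>0. inverse (bessel_I (\<nu> - 1) x / bessel_I \<nu> x + 2 * lommel_b \<mu> \<nu> x / x)
                < lommel_t \<mu> \<nu> x / lommel_t (\<mu> - 1) (\<nu> - 1) x \<and>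
              lommel_t \<mu> \<nu> x / lommel_t (\<mu> - 1) (\<nu> - 1) x < bessel_I \<nu> x / bessel_I (\<nu> - 1) x)) \<and>
     (\<mu> - \<nu> = -1 \<and> \<nu> \<ge> 0 \<longrightarrow>
       (\<forall>x>0. lommel_t \<mu> \<nu> x / lommel_t (\<mu> - 1) (\<nu> - 1) x = bessel_I \<nu> x / bessel_I (\<nu> - 1) x))"
proof -
  have rec: "cross (\<mu> - 1) (\<nu> - 1) x
      = lommel_a (\<mu> - 1) (\<nu> - 1) x * bessel_I (\<nu> - 1) x - cross \<mu> \<nu> x" if "x > 0" for x
    using cross_rec[OF that, of "\<mu> - 1" "\<nu> - 1"] by simp
  \<comment> \<open>On the line \<open>\<mu> = \<nu> - 1\<close> both Lommel functions are Bessel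
    functions, so the two ratios in the last claim coincide.\<close>
  have t_eq_I: "lommel_t \<mu> \<nu> x = bessel_I \<nu> x" "lommel_t (\<mu> - 1) (\<nu> - 1) x = bessel_I (\<nu> - 1) x"
    if "\<mu> - \<nu> = -1" for x
  proof -
    have "\<mu> = \<nu> - 1" using that by simp
    thus "lommel_t \<mu> \<nu> x = bessel_I \<nu> x" "lommel_t (\<mu> - 1) (\<nu> - 1) x = bessel_I (\<nu> - 1) x"
      by (simp_all add: bessel_I_eq_lommel_t)
  qed
  show ?thesis
    unfolding cross_def[symmetric]
  proof (intro conjI impI allI)
    fix x :: real
    assume x: "x > 0"
    show "cross \<mu> \<nu> x > 0"
      if "\<mu> > -1 \<and> \<nu> \<ge> -1 \<and> \<bar>\<nu>\<bar> < \<mu> + 1 \<or> \<mu> > -1 \<and> \<nu> > -1 \<and> -\<mu> - 1 \<le> \<nu> \<and> \<nu> < \<mu> + 1"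
      using that x by (intro cross_pos) auto
    show "cross \<mu> \<nu> x = 0" if "\<mu> - \<nu> = -1 \<or> \<nu> = -1 \<and> \<mu> = 0"
      using that x by (rule cross_eq_0)
    show "cross \<mu> \<nu> x < lommel_a \<mu> \<nu> x * bessel_I \<nu> x"
      if "\<mu> > -2 \<and> \<nu> \<ge> -2 \<and> \<bar>\<nu> + 1\<bar> < \<mu> + 2 \<or>
        \<mu> > -2 \<and> \<nu> > -2 \<and> -\<mu> - 2 \<le> \<nu> + 1 \<and> \<nu> + 1 < \<mu> + 2"
    proof -
      have "cross (\<mu> + 1) (\<nu> + 1) x > 0"
        using that x by (intro cross_pos) auto
      thus ?thesis using cross_rec[OF x, of \<mu> \<nu>] by simp
    qed
    \<comment> \<open>The diagonal shift preserves \<open>\<mu> - \<nu>\<close> and takes the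
      exceptional point (-1, -2) to (0, -1), the one in \<open>cross_eq_0\<close>.\<close>
    show "cross \<mu> \<nu> x = lommel_a \<mu> \<nu> x * bessel_I \<nu> x"
      if "\<mu> - \<nu> = -1 \<or> \<mu> = -1 \<and> \<nu> = -2"
      using that cross_rec[OF x, of \<mu> \<nu>] cross_eq_0[of "\<mu> + 1" "\<nu> + 1" x] x by auto
    show "cross \<mu> \<nu> x < lommel_a (\<mu> - 1) (\<nu> - 1) x * bessel_I (\<nu> - 1) x"
      if "\<mu> > 0 \<and> \<nu> \<ge> 0 \<and> \<bar>\<nu> - 1\<bar> < \<mu> \<or> \<mu> > 0 \<and> \<nu> > 0 \<and> -\<mu> \<le> \<nu> - 1 \<and> \<nu> - 1 < \<mu>"
    proof -
      have "cross (\<mu> - 1) (\<nu> - 1) x > 0"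
        using that x by (intro cross_pos) auto
      thus ?thesis using rec[OF x] by simp
    qed
    show "cross \<mu> \<nu> x = lommel_a (\<mu> - 1) (\<nu> - 1) x * bessel_I (\<nu> - 1) x"
      if "\<mu> - \<nu> = -1 \<or> \<mu> = 1 \<and> \<nu> = 0"
      using that rec[OF x] cross_eq_0[of "\<mu> - 1" "\<nu> - 1" x] x by auto
    show "inverse (bessel_I (\<nu> - 1) x / bessel_I \<nu> x + 2 * lommel_b \<mu> \<nu> x / x)
        < lommel_t \<mu> \<nu> x / lommel_t (\<mu> - 1) (\<nu> - 1) x"
      "lommel_t \<mu> \<nu> x / lommel_t (\<mu> - 1) (\<nu> - 1) x < bessel_I \<nu> x / bessel_I (\<nu> - 1) x"
      if "\<mu> > -1 \<and> 0 \<le> \<nu> \<and> \<nu> < \<mu> + 1"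
      using that x lommel_t_ratio_bounds by blast+
    show "lommel_t \<mu> \<nu> x / lommel_t (\<mu> - 1) (\<nu> - 1) x = bessel_I \<nu> x / bessel_I (\<nu> - 1) x"
      if "\<mu> - \<nu> = -1 \<and> \<nu> \<ge> 0"
      using that by (simp add: t_eq_I)
  qed
qed

end
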